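(* Let $n>2$ and let $S$ be a uniform $(n\times n)/k$ semi-Latin square. Then: 1. the canonical efficiency factors of $S$ are $1-1/(n-1)$, with multiplicity $(n-1)^2$, and $1$, with multiplicity $nk-1-(n-1)^2$; 2. the uniform $(n\times n)/k$ semi-Latin squares are precisely the Schur optimal designs in the class of all $(n\times n)/k$ semi-Latin squares.
   Context: For integers $n>2$ and $k>0$, an $(n\times n)/k$ semi-Latin square is an $n\times n$ array of $k$-subsets (called blocks) of an $nk$-set (of treatments), such that each treatment occurs once in each row and once in each column of the array. It is uniform if every pair of blocks, not in the same row or column, intersect in the same positive number $\mu$ of treatments (in which case $k=\mu(n-1)$). A $(v,b,r,k)$-design is a block design with $v$ treatments and $b$ blocks (a list, repetitions allowed), each block being a $k$-subset of the set of treatments, such that each treatment is in exactly $r$ blocks. The underlying block design of an $(n\times n)/k$ semi-Latin square is the $(nk,n^2,n,k)$-design obtained by taking its $n^2$ cells as blocks and ignoring the array structure. The concurrence matrix $\Lambda$ of a $(v,b,r,k)$-design $\Delta$ is the $v\times v$ matrix, with rows and columns indexed by the treatments, whose $(\alpha,\beta)$-entry is the number of blocks containing both $\alpha$ and $\beta$. The scaled information matrix is $F(\Delta)=I_v-(rk)^{-1}\Lambda$. Its eigenvalues are real and lie in $[0,1]$; the all-$1$ vector is an eigenvector with eigenvalue $0$. The remaining $v-1$ eigenvalues (counting repeats) are the canonical efficiency factors of $\Delta$. The canonical efficiency factors of a semi-Latin square are those of its underlying block design. A design $\Delta$ with canonical efficiency factors $\delta_1\le\cdots\le\delta_{v-1}$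 is Schur optimal in a class $\mathcal{C}$ of $(v,b,r,k)$-designs containing $\Delta$ if for each design $\Gamma\in\mathcal{C}$, with canonical efficiency factors $\gamma_1\le\cdots\le\gamma_{v-1}$, we have $\sum_{i=1}^{\ell}\delta_i\ge\sum_{i=1}^{\ell}\gamma_i$ for $\ell=1,\ldots,v-1$. An $(n\times n)/k$ semi-Latin square is Schur optimal if its underlying block design is Schur optimal in the class of underlying block designs of all $(n\times n)/k$ semi-Latin squares. *)

theory Defs
  imports Complex_Main "Jordan_Normal_Form.Char_Poly"
begin

text \<open>A design is a set of treatments together with a list of blocks (repetitions allowed).\<close>

type_synonym 'a design = "'a set \<times> 'a set list"

definition is_design :: "nat \<Rightarrow> nat \<Rightarrow> nat \<Rightarrow> nat \<Rightarrow> 'a design \<Rightarrow> bool" where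
  "is_design v b r k D \<longleftrightarrow>
     finite (fst D) \<and> card (fst D) = v \<and> length (snd D) = b \<and>
     (\<forall>B \<in> set (snd D). B \<subseteq> fst D \<and> card B = k) \<and>
     (\<forall>x \<in> fst D. length (filter (\<lambda>B. x \<in> B) (snd D)) = r)"

definition concurrence :: "'a design \<Rightarrow> 'a \<Rightarrow> 'a \<Rightarrow> nat" where
  "concurrence D x y = length (filter (\<lambda>B. x \<in> B \<and> y \<in> B) (snd D))"

definition info_entry :: "nat \<Rightarrow> nat \<Rightarrow> 'a design \<Rightarrow> 'a \<Rightarrow> 'a \<Rightarrow> real" where
  "info_entry r k D x y =
     (if x = y then 1 else 0) - real (concurrence D x y) / (real r * real k)"

text \<open>
  The library's matrices are indexed by initial segments of the naturals. A matrix indexed by a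
  finite set \<open>V\<close> is therefore written down along an enumeration of \<open>V\<close>. Which enumeration is
  taken does not matter for the characteristic polynomial: see \<open>char_poly_enum_mat\<close> below.
\<close>

definition matrix_along :: "nat \<Rightarrow> (nat \<Rightarrow> 'a) \<Rightarrow> ('a \<Rightarrow> 'a \<Rightarrow> 'b) \<Rightarrow> 'b mat" where
  "matrix_along n e f = mat n n (\<lambda>(i, j). f (e i) (e j))"

definition enum_mat :: "'a set \<Rightarrow> ('a \<Rightarrow> 'a \<Rightarrow> 'b) \<Rightarrow> 'b mat" where
  "enum_mat V f =
     matrix_along (card V) (SOME e. bij_betw e {..<card V} V) f"

definition info_matrix :: "nat \<Rightarrow> nat \<Rightarrow> 'a design \<Rightarrow> real mat" where
  "info_matrix r k D = enum_mat (fst D) (info_entry r k D)"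

text \<open>
  The eigenvalues with multiplicity are the roots of the characteristic polynomial; they are all
  real because the matrix is symmetric. One copy of the eigenvalue 0, belonging to the all-1
  vector, is removed; any further zeros (for disconnected designs) are kept.
\<close>

definition canonical_efficiency_factors :: "nat \<Rightarrow> nat \<Rightarrow> 'a design \<Rightarrow> real multiset" where
  "canonical_efficiency_factors r k D = proots (char_poly (info_matrix r k D)) - {#0#}"

definition schur_optimal ::
  "nat \<Rightarrow> nat \<Rightarrow> nat \<Rightarrow> nat \<Rightarrow> 'a design set \<Rightarrow> 'a design \<Rightarrow> bool" where
  "schur_optimal v b r k C D \<longleftrightarrow>
     (\<forall>E \<in> C. is_design v b r k E) \<and> D \<in> C \<and>
     (\<forall>E \<in> C. \<forall>l \<in> {1..v - 1}.
        sum_list (take l (sorted_list_of_multiset (canonical_efficiency_factors r k D)))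
        \<ge> sum_list (take l (sorted_list_of_multiset (canonical_efficiency_factors r k E))))"

text \<open>
  The array \<open>A\<close> has rows and columns numbered \<open>0, \<dots>, n - 1\<close>; its values outside this range are
  irrelevant.
\<close>

definition semi_latin_square :: "nat \<Rightarrow> nat \<Rightarrow> 'a set \<Rightarrow> (nat \<Rightarrow> nat \<Rightarrow> 'a set) \<Rightarrow> bool" where
  "semi_latin_square n k V A \<longleftrightarrow>
     n > 2 \<and> k > 0 \<and> finite V \<and> card V = n * k \<and>
     (\<forall>i<n. \<forall>j<n. A i j \<subseteq> V \<and> card (A i j) = k) \<and>
     (\<forall>x\<in>V. \<forall>i<n. \<exists>!j. j < n \<and> x \<in> A i j) \<and>
     (\<forall>x\<in>V. \<forall>j<n. \<exists>!i. i < n \<and> x \<in> A i j)"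

definition uniform_semi_latin_square ::
  "nat \<Rightarrow> nat \<Rightarrow> 'a set \<Rightarrow> (nat \<Rightarrow> nat \<Rightarrow> 'a set) \<Rightarrow> bool" where
  "uniform_semi_latin_square n k V A \<longleftrightarrow>
     semi_latin_square n k V A \<and>
     (\<exists>\<mu>>0. \<forall>i<n. \<forall>j<n. \<forall>i'<n. \<forall>j'<n.
        i \<noteq> i' \<and> j \<noteq> j' \<longrightarrow> card (A i j \<inter> A i' j') = \<mu>)"

definition underlying_design :: "nat \<Rightarrow> 'a set \<Rightarrow> (nat \<Rightarrow> nat \<Rightarrow> 'a set) \<Rightarrow> 'a design" where
  "underlying_design n V A =
     (V, map (\<lambda>(i, j). A i j) (List.product [0..<n] [0..<n]))"

definition sls_efficiency_factors ::
  "nat \<Rightarrow> nat \<Rightarrow> 'a set \<Rightarrow> (nat \<Rightarrow> nat \<Rightarrow> 'a set) \<Rightarrow> real multiset" where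
  "sls_efficiency_factors n k V A =
     canonical_efficiency_factors n k (underlying_design n V A)"

definition sls_designs :: "nat \<Rightarrow> nat \<Rightarrow> 'a design set" where
  "sls_designs n k = {underlying_design n V A | V A. semi_latin_square n k V A}"

definition schur_optimal_sls ::
  "nat \<Rightarrow> nat \<Rightarrow> 'a set \<Rightarrow> (nat \<Rightarrow> nat \<Rightarrow> 'a set) \<Rightarrow> bool" where
  "schur_optimal_sls n k V A \<longleftrightarrow>
     semi_latin_square n k V A \<and>
     schur_optimal (n * k) (n\<^sup>2) n k (sls_designs n k) (underlying_design n V A)"

lemma char_poly_matrix_along:
  fixes f :: "'a \<Rightarrow> 'a \<Rightarrow> 'b :: field"
  assumes e: "bij_betw e {..<n} V" and e': "bij_betw e' {..<n} V"
  shows "char_poly (matrix_along n e f) = char_poly (matrix_along n e' f)"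
proof -
  define p where "p = inv_into {..<n} e' \<circ> e"
  have p: "bij_betw p {..<n} {..<n}"
    unfolding p_def by (rule bij_betw_trans[OF e bij_betw_inv_into[OF e']])
  have ep: "e' (p i) = e i" if "i < n" for i
  proof -
    have "e i \<in> V" using bij_betwE[OF e] that by blast
    thus ?thesis unfolding p_def o_def by (rule bij_betw_inv_into_right[OF e'])
  qed
  have pn: "p i < n" if "i < n" for i using bij_betwE[OF p] that by blast
  have pinj: "p i = p j \<longleftrightarrow> i = j" if "i < n" "j < n" for i j
    using inj_on_eq_iff[OF bij_betw_imp_inj_on[OF p], of i j] that by blast
  define P :: "'b mat" where "P = mat n n (\<lambda>(i, j). if p i = j then 1 else 0)"
  define Q :: "'b mat" where "Q = mat n n (\<lambda>(i, j). if p j = i then 1 else 0)"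
  define A where "A = matrix_along n e f"
  define B where "B = matrix_along n e' f"
  have c: "A \<in> carrier_mat n n" "B \<in> carrier_mat n n" "P \<in> carrier_mat n n" "Q \<in> carrier_mat n n"
    by (simp_all add: A_def B_def matrix_along_def P_def Q_def)
  have PM: "(P * M) $$ (i, j) = M $$ (p i, j)"
    if "i < n" "j < n" and M: "M \<in> carrier_mat n n" for i j M
  proof -
    have "(P * M) $$ (i, j) = (\<Sum>l\<in>{0..<n}. P $$ (i, l) * M $$ (l, j))"
      using that c by (simp add: scalar_prod_def)
    also have "\<dots> = (\<Sum>l\<in>{0..<n}. if p i = l then M $$ (l, j) else 0)"
      by (rule sum.cong) (simp_all add: that P_def)
    finally show ?thesis using pn[OF that(1)] by simp
  qed
  have MQ: "(M * Q) $$ (i, j) = M $$ (i, p j)"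
    if "i < n" "j < n" and M: "M \<in> carrier_mat n n" for i j M
  proof -
    have "(M * Q) $$ (i, j) = (\<Sum>l\<in>{0..<n}. M $$ (i, l) * Q $$ (l, j))"
      using that c by (simp add: scalar_prod_def)
    also have "\<dots> = (\<Sum>l\<in>{0..<n}. if p j = l then M $$ (i, l) else 0)"
      by (rule sum.cong) (simp_all add: that Q_def)
    finally show ?thesis using pn[OF that(2)] by simp
  qed
  have PQ: "P * Q = 1\<^sub>m n"
  proof (rule eq_matI)
    fix i j assume "i < dim_row (1\<^sub>m n :: 'b mat)" "j < dim_col (1\<^sub>m n :: 'b mat)"
    hence ij: "i < n" "j < n" by simp_all
    have "(P * Q) $$ (i, j) = Q $$ (p i, j)" by (rule PM[OF ij c(4)])
    also have "\<dots> = (if p j = p i then 1 else 0)" unfolding Q_def using ij pn by simp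
    finally show "(P * Q) $$ (i, j) = 1\<^sub>m n $$ (i, j)" using ij pinj[OF ij(2,1)] by simp
  qed (use c in simp_all)
  have QP: "Q * P = 1\<^sub>m n" by (rule mat_mult_left_right_inverse[OF c(3,4) PQ])
  have "A = P * B * Q"
  proof (rule eq_matI)
    fix i j assume "i < dim_row (P * B * Q)" "j < dim_col (P * B * Q)"
    hence ij: "i < n" "j < n" using c by simp_all
    have "(P * B * Q) $$ (i, j) = (P * B) $$ (i, p j)" using ij c by (intro MQ) simp_all
    also have "\<dots> = B $$ (p i, p j)" using ij pn c by (intro PM) simp_all
    finally show "A $$ (i, j) = (P * B * Q) $$ (i, j)"
      using ij pn ep by (simp add: A_def B_def matrix_along_def)
  qed (use c in simp_all)
  hence "similar_mat A B" using c PQ QP by (intro similar_matI[of A B P Q n]) simp_all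
  thus ?thesis unfolding A_def B_def by (rule char_poly_similar)
qed

lemma char_poly_enum_mat:
  fixes f :: "'a \<Rightarrow> 'a \<Rightarrow> 'b :: field"
  assumes "bij_betw e {..<card V} V"
  shows "char_poly (enum_mat V f) = char_poly (matrix_along (card V) e f)"
  unfolding enum_mat_def
  by (rule char_poly_matrix_along[OF someI[of "\<lambda>e. bij_betw e {..<card V} V", OF assms] assms])

end

theory Submission
  imports Defs "Jordan_Normal_Form.Schur_Decomposition"
begin

text \<open>
  Rows and columns of the array force the incidence vectors of the cells into a space of dimension
  \<open>(n - 1)\<^sup>2 + 1\<close>, so for every semi-Latin square all but \<open>(n - 1)\<^sup>2\<close> canonical
  efficiency factors equal 1. The trace of the information matrix makes the mean of the remaining
  ones \<open>c = 1 - 1 / (n - 1)\<close>, and the trace of its square makes the sum of their squared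
  deviations from \<open>c\<close> a positive multiple of the sum, over pairs of cells in different rows and
  columns, of the squared deviation of the block intersection size from its mean \<open>k / (n - 1)\<close>.
  Hence the square is uniform iff all the remaining factors equal \<open>c\<close>. Replacing a part of a
  sorted list by its mean can only increase the prefix sums, which gives Schur optimality;
  conversely, equal prefix sums determine the factors.
\<close>

section \<open>Linear algebra: spectra of real symmetric matrices, traces, low-rank
  perturbations\<close>

lemma proots_prod_linear_factors:
  fixes as :: "'a :: idom list"
  shows "proots (\<Prod>a\<leftarrow>as. [:- a, 1:]) = mset as"
proof (induction as)
  case (Cons a as)
  have "(\<Prod>a\<leftarrow>as. [:- a, 1:]) \<noteq> 0" by (auto simp: prod_list_zero_iff)
  with Cons show ?case by (simp add: proots_mult del: mult_pCons_left)
qed simp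

text \<open>For an eigenvector \<open>v\<close>, the Hermitian form \<open>q\<close> of the matrix
  at \<open>v\<close> is its own conjugate, by symmetry, and equals \<open>z\<close> times the
  positive real squared norm \<open>s\<close> of \<open>v\<close>.\<close>

lemma symmetric_eigenvalue_real:
  fixes A :: "real mat" and z :: complex
  assumes A: "A \<in> carrier_mat n n"
    and sym: "\<And>i j. i < n \<Longrightarrow> j < n \<Longrightarrow> A $$ (i, j) = A $$ (j, i)"
    and ev: "eigenvalue (map_mat of_real A) z"
  shows "z \<in> \<real>"
proof -
  let ?C = "map_mat complex_of_real A"
  have C: "?C \<in> carrier_mat n n" using A by simp
  obtain v where v: "v \<in> carrier_vec n" "v \<noteq> 0\<^sub>v n" "?C *\<^sub>v v = z \<cdot>\<^sub>v v"
    using ev A unfolding eigenvalue_def eigenvector_def by auto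
  have row: "(\<Sum>j<n. of_real (A $$ (i, j)) * v $ j) = z * v $ i" if "i < n" for i
  proof -
    have "(?C *\<^sub>v v) $ i = (z \<cdot>\<^sub>v v) $ i" using v(3) by simp
    thus ?thesis using that v(1) A by (simp add: scalar_prod_def atLeast0LessThan)
  qed
  define q where "q = (\<Sum>i<n. \<Sum>j<n. cnj (v $ i) * of_real (A $$ (i, j)) * v $ j)"
  define s where "s = (\<Sum>i<n. (cmod (v $ i))\<^sup>2)"
  have "cnj q = (\<Sum>i<n. \<Sum>j<n. v $ i * of_real (A $$ (i, j)) * cnj (v $ j))"
    by (simp add: q_def)
  also have "\<dots> = (\<Sum>j<n. \<Sum>i<n. v $ i * of_real (A $$ (i, j)) * cnj (v $ j))"
    by (rule sum.swap)
  also have "\<dots> = q"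
    unfolding q_def by (intro sum.cong) (auto simp: sym mult_ac)
  finally have qr: "cnj q = q" .
  have "q = (\<Sum>i<n. cnj (v $ i) * (z * v $ i))"
    unfolding q_def by (intro sum.cong refl) (simp add: row[symmetric] sum_distrib_left mult.assoc)
  also have "\<dots> = z * of_real s"
    unfolding s_def of_real_sum sum_distrib_left
    by (intro sum.cong refl, subst complex_norm_square) (simp add: mult_ac)
  finally have qz: "q = z * of_real s" .
  obtain i where i: "i < n" "v $ i \<noteq> 0"
    using v(1,2) by (metis carrier_vecD eq_vecI index_zero_vec)
  have "s > 0" unfolding s_def by (rule sum_pos2[of _ i]) (use i in auto)
  with qr qz have "cnj z = z" by simp
  thus ?thesis by (simp add: Reals_cnj_iff)
qed

text \<open>The characteristic polynomial splits over the complex numbers, where all its roots are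
  real by \<open>symmetric_eigenvalue_real\<close>; this factorization descends to the
  reals.\<close>

lemma char_poly_symmetric_splits:
  fixes A :: "real mat"
  assumes A: "A \<in> carrier_mat n n"
    and sym: "\<And>i j. i < n \<Longrightarrow> j < n \<Longrightarrow> A $$ (i, j) = A $$ (j, i)"
  obtains as where "char_poly A = (\<Prod>a\<leftarrow>as. [:- a, 1:])" "length as = n"
proof -
  let ?C = "map_mat complex_of_real A"
  have C: "?C \<in> carrier_mat n n" using A by simp
  obtain zs where zs: "char_poly ?C = (\<Prod>z\<leftarrow>zs. [:- z, 1:])" "length zs = n"
    using char_poly_factorized[OF C] by blast
  have real: "of_real (Re z) = z" if "z \<in> set zs" for z
  proof -
    have "poly (char_poly ?C) z = 0"
      using that unfolding zs(1) by (auto simp: poly_prod_list prod_list_zero_iff)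
    hence "eigenvalue ?C z" using eigenvalue_root_char_poly[OF C] by simp
    with A sym have "z \<in> \<real>" by (rule symmetric_eigenvalue_real)
    thus ?thesis by (simp add: of_real_Re)
  qed
  \<comment> \<open>Embedding real polynomials coefficientwise into complex ones is an injective
    ring homomorphism, so an identity between the images can be pulled back.\<close>
  interpret h: map_poly_inj_comm_ring_hom complex_of_real ..
  have "map_poly complex_of_real (\<Prod>a\<leftarrow>map Re zs. [:- a, 1:]) =
          (\<Prod>a\<leftarrow>map Re zs. map_poly complex_of_real [:- a, 1:])"
    by (simp add: h.hom_prod_list o_def)
  also have "\<dots> = (\<Prod>z\<leftarrow>zs. [:- z, 1:])"
    by (rule arg_cong[of _ _ prod_list]) (auto simp: real)
  also have "\<dots> = map_poly complex_of_real (char_poly A)"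
    unfolding zs(1)[symmetric] by (rule of_real_hom.char_poly_hom[OF A])
  finally have "char_poly A = (\<Prod>a\<leftarrow>map Re zs. [:- a, 1:])"
    by (simp only: h.eq_iff)
  with zs(2) show ?thesis by (intro that[of "map Re zs"]) simp_all
qed

lemma sum_diag_mult_commute:
  fixes X Y :: "'a :: comm_semiring_0 mat"
  assumes "X \<in> carrier_mat n m" "Y \<in> carrier_mat m n"
  shows "(\<Sum>i<n. (X * Y) $$ (i, i)) = (\<Sum>i<m. (Y * X) $$ (i, i))"
proof -
  have "(\<Sum>i<n. (X * Y) $$ (i, i)) = (\<Sum>i<n. \<Sum>j<m. X $$ (i, j) * Y $$ (j, i))"
    using assms by (intro sum.cong) (auto simp: scalar_prod_def atLeast0LessThan)
  also have "\<dots> = (\<Sum>j<m. \<Sum>i<n. X $$ (i, j) * Y $$ (j, i))" by (rule sum.swap)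
  also have "\<dots> = (\<Sum>i<m. (Y * X) $$ (i, i))"
    using assms by (intro sum.cong) (auto simp: scalar_prod_def atLeast0LessThan mult.commute)
  finally show ?thesis .
qed

lemma sum_diag_similar:
  fixes A B :: "'a :: comm_ring_1 mat"
  assumes "similar_mat_wit A B P Q" "A \<in> carrier_mat n n"
  shows "(\<Sum>i<n. A $$ (i, i)) = (\<Sum>i<n. B $$ (i, i))"
proof -
  note w = similar_mat_witD2[OF assms(2,1)]
  have "(\<Sum>i<n. A $$ (i, i)) = (\<Sum>i<n. (P * (B * Q)) $$ (i, i))"
    using w by (simp add: assoc_mult_mat[of P n n B n Q n])
  also have "\<dots> = (\<Sum>i<n. (B * Q * P) $$ (i, i))"
    using w by (intro sum_diag_mult_commute) auto
  also have "B * Q * P = B"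
    using w by (simp add: assoc_mult_mat[of B n n Q n P n])
  finally show ?thesis .
qed

text \<open>Traces are invariant under similarity, so the matrix may be replaced by its upper
  triangular Schur form \<open>B\<close>, whose diagonal is \<open>as\<close>. The same similarity
  carries the square of the matrix to that of \<open>B\<close>.\<close>

lemma sum_diag_eq_sum_roots:
  fixes A :: "'a :: conjugatable_ordered_field mat"
  assumes A: "A \<in> carrier_mat n n"
    and cp: "char_poly A = (\<Prod>a\<leftarrow>as. [:- a, 1:])"
  shows "(\<Sum>i<n. A $$ (i, i)) = (\<Sum>a\<leftarrow>as. a)"
    and "(\<Sum>i<n. (A * A) $$ (i, i)) = (\<Sum>a\<leftarrow>as. a\<^sup>2)"
proof -
  obtain B P Q where "schur_decomposition A as = (B, P, Q)"
    by (cases "schur_decomposition A as") auto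
  from schur_decomposition[OF A cp this]
  have w: "similar_mat_wit A B P Q" and ut: "upper_triangular B" and d: "diag_mat B = as"
    by auto
  note w2 = similar_mat_witD2[OF A w]
  have B: "B \<in> carrier_mat n n" using w2 by simp
  have as: "as = map (\<lambda>i. B $$ (i, i)) [0..<n]" using d B by (simp add: diag_mat_def)
  have sl: "(\<Sum>a\<leftarrow>as. g a) = (\<Sum>i<n. g (B $$ (i, i)))" for g :: "'a \<Rightarrow> 'a"
    by (simp add: as o_def interv_sum_list_conv_sum_set_nat atLeast0LessThan)
  show "(\<Sum>i<n. A $$ (i, i)) = (\<Sum>a\<leftarrow>as. a)"
    unfolding sl by (rule sum_diag_similar[OF w A])
  have "similar_mat_wit (A ^\<^sub>m 2) (B ^\<^sub>m 2) P Q" by (rule similar_mat_wit_pow[OF w])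
  moreover have "A ^\<^sub>m 2 = A * A" "B ^\<^sub>m 2 = B * B" using A B by (simp_all add: numeral_2_eq_2)
  ultimately have "similar_mat_wit (A * A) (B * B) P Q" by simp
  hence "(\<Sum>i<n. (A * A) $$ (i, i)) = (\<Sum>i<n. (B * B) $$ (i, i))"
    by (rule sum_diag_similar) (use A in auto)
  also have "\<dots> = (\<Sum>i<n. (B $$ (i, i))\<^sup>2)"
  proof (rule sum.cong[OF refl])
    fix i assume i: "i \<in> {..<n}"
    have "(B * B) $$ (i, i) = (\<Sum>j<n. B $$ (i, j) * B $$ (j, i))"
      using i B by (auto simp: scalar_prod_def atLeast0LessThan)
    \<comment> \<open>For \<open>j\<close> different from \<open>i\<close>, one of the entries at
      \<open>(i, j)\<close> and \<open>(j, i)\<close> lies below the diagonal and vanishes.\<close>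
    also have "\<dots> = (\<Sum>j<n. if j = i then (B $$ (i, i))\<^sup>2 else 0)"
    proof (rule sum.cong[OF refl])
      fix j assume j: "j \<in> {..<n}"
      have z: "B $$ (p, q) = 0" if "q < p" "p < n" for p q
        using upper_triangularD[OF ut that(1)] that(2) B by auto
      show "B $$ (i, j) * B $$ (j, i) = (if j = i then (B $$ (i, i))\<^sup>2 else 0)"
        using z[of i j] z[of j i] i j
        by (cases i j rule: linorder_cases) (auto simp: power2_eq_square)
    qed
    also have "\<dots> = (B $$ (i, i))\<^sup>2" using i by simp
    finally show "(B * B) $$ (i, i) = (B $$ (i, i))\<^sup>2" .
  qed
  finally show "(\<Sum>i<n. (A * A) $$ (i, i)) = (\<Sum>a\<leftarrow>as. a\<^sup>2)" unfolding sl .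
qed

text \<open>The determinant of the block matrix \<open>U\<close> is computed twice: multiplying by
  \<open>L\<close> on the right (determinant 1) or by \<open>M\<close> on the left (determinant
  \<open>t ^ r\<close>) clears the lower left block. The form without division allows
  \<open>t\<close> to be a polynomial.\<close>

lemma sylvester_determinant:
  fixes X Y :: "'a :: idom mat"
  assumes X: "X \<in> carrier_mat n r" and Y: "Y \<in> carrier_mat r n"
  shows "t ^ r * det (t \<cdot>\<^sub>m 1\<^sub>m n + X * Y) = t ^ n * det (t \<cdot>\<^sub>m 1\<^sub>m r + Y * X)"
proof -
  define U where "U = four_block_mat (t \<cdot>\<^sub>m 1\<^sub>m n) (- X) Y (1\<^sub>m r)"
  define L where "L = four_block_mat (1\<^sub>m n) (0\<^sub>m n r) (- Y) (1\<^sub>m r)"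
  define M where "M = four_block_mat (1\<^sub>m n) (0\<^sub>m n r) (- Y) (t \<cdot>\<^sub>m 1\<^sub>m r)"
  have U: "U \<in> carrier_mat (n + r) (n + r)" "L \<in> carrier_mat (n + r) (n + r)"
      "M \<in> carrier_mat (n + r) (n + r)"
    unfolding U_def L_def M_def by (auto intro!: four_block_carrier_mat)
  have "U * L = four_block_mat (t \<cdot>\<^sub>m 1\<^sub>m n * 1\<^sub>m n + (- X) * (- Y)) (t \<cdot>\<^sub>m 1\<^sub>m n * 0\<^sub>m n r + (- X) * 1\<^sub>m r)
      (Y * 1\<^sub>m n + 1\<^sub>m r * (- Y)) (Y * 0\<^sub>m n r + 1\<^sub>m r * 1\<^sub>m r)"
    unfolding U_def L_def by (rule mult_four_block_mat) (use X Y in auto)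
  also have "\<dots> = four_block_mat (t \<cdot>\<^sub>m 1\<^sub>m n + X * Y) (- X) (0\<^sub>m r n) (1\<^sub>m r)"
    using X Y by (intro cong_four_block_mat) (auto intro!: eq_matI)
  finally have "det (U * L) = det (t \<cdot>\<^sub>m 1\<^sub>m n + X * Y)"
    using X Y by (simp add: det_four_block_mat_lower_left_zero[where n = n and m = r])
  moreover have "det L = 1"
    unfolding L_def using Y by (subst det_four_block_mat_upper_right_zero[where n = n and m = r]) auto
  ultimately have 1: "det U = det (t \<cdot>\<^sub>m 1\<^sub>m n + X * Y)"
    using det_mult[OF U(1,2)] by simp
  have "M * U = four_block_mat (1\<^sub>m n * (t \<cdot>\<^sub>m 1\<^sub>m n) + 0\<^sub>m n r * Y) (1\<^sub>m n * (- X) + 0\<^sub>m n r * 1\<^sub>m r)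
      ((- Y) * (t \<cdot>\<^sub>m 1\<^sub>m n) + t \<cdot>\<^sub>m 1\<^sub>m r * Y) ((- Y) * (- X) + t \<cdot>\<^sub>m 1\<^sub>m r * 1\<^sub>m r)"
    unfolding U_def M_def by (rule mult_four_block_mat) (use X Y in auto)
  also have "\<dots> = four_block_mat (t \<cdot>\<^sub>m 1\<^sub>m n) (- X) (0\<^sub>m r n) (t \<cdot>\<^sub>m 1\<^sub>m r + Y * X)"
    using X Y by (intro cong_four_block_mat) (auto intro!: eq_matI)
  finally have "det (M * U) = t ^ n * det (t \<cdot>\<^sub>m 1\<^sub>m r + Y * X)"
    using X Y by (simp add: det_four_block_mat_lower_left_zero[where n = n and m = r] det_smult)
  moreover have "det M = t ^ r"
    unfolding M_def using Y
    by (subst det_four_block_mat_upper_right_zero[where n = n and m = r]) (auto simp: det_smult)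
  ultimately have "t ^ r * det U = t ^ n * det (t \<cdot>\<^sub>m 1\<^sub>m r + Y * X)"
    using det_mult[OF U(3,1)] by simp
  with 1 show ?thesis by simp
qed

text \<open>Sylvester's identity over the polynomial ring, with \<open>t\<close> the linear
  polynomial vanishing at \<open>c\<close>, extracts \<open>n - r\<close> factors \<open>t\<close>
  from the characteristic polynomial. This turns the rank bound on the concurrence matrix into a
  multiplicity.\<close>

lemma order_char_poly_low_rank_perturbation:
  fixes A X Y :: "'a :: field mat"
  assumes X: "X \<in> carrier_mat n r" and Y: "Y \<in> carrier_mat r n"
    and A: "A = c \<cdot>\<^sub>m 1\<^sub>m n - X * Y" 
  shows "n - r \<le> Polynomial.order c (char_poly A)"
proof (cases "r \<le> n")
  case True
  have Ac: "A \<in> carrier_mat n n" using X Y unfolding A by auto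
  let ?h = "map_mat (\<lambda>a. [:a:])"
  let ?t = "[:- c, 1:]"
  have X': "?h X \<in> carrier_mat n r" and Y': "?h Y \<in> carrier_mat r n" using X Y by auto
  have "char_poly_matrix A = ?t \<cdot>\<^sub>m 1\<^sub>m n + ?h (X * Y)"
    unfolding char_poly_matrix_def A using X Y by (intro eq_matI) auto
  also have "?h (X * Y) = ?h X * ?h Y"
    by (rule map_poly_mult(1)[OF X Y])
  finally have "char_poly A = det (?t \<cdot>\<^sub>m 1\<^sub>m n + ?h X * ?h Y)" by (simp add: char_poly_def)
  hence "?t ^ r * char_poly A = ?t ^ n * det (?t \<cdot>\<^sub>m 1\<^sub>m r + ?h Y * ?h X)"
    using sylvester_determinant[OF X' Y'] by simp
  \<comment> \<open>Splitting the power lets \<open>?t ^ r\<close> be cancelled in the integral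
    domain of polynomials.\<close>
  also have "?t ^ n = ?t ^ r * ?t ^ (n - r)" using True by (simp flip: power_add)
  finally have "char_poly A = ?t ^ (n - r) * det (?t \<cdot>\<^sub>m 1\<^sub>m r + ?h Y * ?h X)"
    by (simp add: mult.assoc del: mult_pCons_left)
  hence "?t ^ (n - r) dvd char_poly A" by simp
  moreover have "char_poly A \<noteq> 0" using degree_monic_char_poly[OF Ac] by auto
  ultimately show ?thesis by (simp add: Polynomial.order_divides)
qed simp

section \<open>Counting in the array: incidences, block intersections, concurrences\<close>

text \<open>Blocks may repeat, so counts over the block list become sums over cells rather than over
  a set of blocks.\<close>

lemma filter_map_product_length:
  "real (length (filter P (map (\<lambda>(i, j). T i j) (List.product [0..<n] [0..<n])))) =
     (\<Sum>(i, j)\<in>{..<n} \<times> {..<n}. of_bool (P (T i j)))"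
proof -
  have len: "real (length (filter P xs)) = (\<Sum>x\<leftarrow>xs. of_bool (P x))" for xs :: "'a list"
    by (induction xs) auto
  have "real (length (filter P (map (\<lambda>(i, j). T i j) (List.product [0..<n] [0..<n])))) =
      (\<Sum>p\<leftarrow>List.product [0..<n] [0..<n]. of_bool (P (case p of (i, j) \<Rightarrow> T i j)))"
    unfolding len by (simp add: o_def)
  also have "\<dots> = (\<Sum>p\<in>{..<n} \<times> {..<n}. of_bool (P (case p of (i, j) \<Rightarrow> T i j)))"
    by (subst sum_list_distinct_conv_sum_set) (auto simp: distinct_product atLeast0LessThan)
  finally show ?thesis by (simp add: case_prod_unfold)
qed

lemma sum_of_bool_ex1:
  assumes "finite I" "\<exists>!i. i \<in> I \<and> P i"
  shows "(\<Sum>i\<in>I. of_bool (P i)) = (1 :: 'a :: comm_semiring_1)"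
proof -
  obtain i where i: "i \<in> I" "P i" "\<And>j. j \<in> I \<Longrightarrow> P j \<Longrightarrow> j = i" using assms(2) by blast
  have "(\<Sum>j\<in>I. of_bool (P j)) = (\<Sum>j\<in>I. if j = i then 1 else (0 :: 'a))"
  proof (intro sum.cong refl)
    fix j assume "j \<in> I"
    hence "P j \<longleftrightarrow> j = i" using i by blast
    thus "of_bool (P j) = (if j = i then 1 else (0 :: 'a))" by simp
  qed
  thus ?thesis using i(1) assms(1) by simp
qed

locale semi_latin =
  fixes n k :: nat and V :: "'a set" and A :: "nat \<Rightarrow> nat \<Rightarrow> 'a set"
  assumes sls: "semi_latin_square n k V A"
begin

abbreviation "cells \<equiv> {..<n} \<times> {..<n}"

text \<open>The real incidence matrix between cells and treatments. Both \<open>meet\<close> and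
  \<open>conc\<close> are Gram matrices formed from it, one indexed by cells and one by
  treatments.\<close>

definition inc :: "nat \<times> nat \<Rightarrow> 'a \<Rightarrow> real" where
  "inc p x = of_bool (x \<in> A (fst p) (snd p))"

definition opp :: "nat \<times> nat \<Rightarrow> (nat \<times> nat) set" where
  "opp p = ({..<n} - {fst p}) \<times> ({..<n} - {snd p})"

definition meet :: "nat \<times> nat \<Rightarrow> nat \<times> nat \<Rightarrow> real" where
  "meet p q = (\<Sum>x\<in>V. inc p x * inc q x)"

definition conc :: "'a \<Rightarrow> 'a \<Rightarrow> real" where
  "conc x y = (\<Sum>p\<in>cells. inc p x * inc p y)"

text \<open>By \<open>sum_meet_opp\<close> and \<open>card_opp\<close>, the subtracted number is the
  mean of \<open>meet p\<close> over \<open>opp p\<close>.\<close>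

definition deviation :: real where
  "deviation = (\<Sum>p\<in>cells. \<Sum>q\<in>opp p. (meet p q - k / (real n - 1))\<^sup>2)"

lemma n_gt_2: "n > 2" and k_pos: "k > 0" and finite_V: "finite V" and card_V: "card V = n * k"
  using sls by (auto simp: semi_latin_square_def)

lemma inc_idem: "inc p x * inc p x = inc p x"
  by (simp add: inc_def)

lemma cell_subset: "i < n \<Longrightarrow> j < n \<Longrightarrow> A i j \<subseteq> V"
  and card_cell: "i < n \<Longrightarrow> j < n \<Longrightarrow> card (A i j) = k"
  using sls by (auto simp: semi_latin_square_def)

lemma inc_sum_row: "x \<in> V \<Longrightarrow> i < n \<Longrightarrow> (\<Sum>j<n. inc (i, j) x) = 1"
  unfolding inc_def by (rule sum_of_bool_ex1) (use sls in \<open>auto simp: semi_latin_square_def\<close>)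

lemma inc_sum_col: "x \<in> V \<Longrightarrow> j < n \<Longrightarrow> (\<Sum>i<n. inc (i, j) x) = 1"
  unfolding inc_def by (rule sum_of_bool_ex1) (use sls in \<open>auto simp: semi_latin_square_def\<close>)

lemma inc_sum_cells: "x \<in> V \<Longrightarrow> (\<Sum>p\<in>cells. inc p x) = n"
  by (simp add: sum.cartesian_product' inc_sum_row)

lemma meet_eq_card:
  assumes "p \<in> cells"
  shows "meet p q = card (A (fst p) (snd p) \<inter> A (fst q) (snd q))"
proof -
  have sub: "A (fst p) (snd p) \<subseteq> V" using assms cell_subset[of "fst p" "snd p"] by auto
  have "meet p q = (\<Sum>x\<in>V. of_bool (x \<in> A (fst p) (snd p) \<inter> A (fst q) (snd q)))"
    unfolding meet_def inc_def by (intro sum.cong) auto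
  also have "\<dots> = card (V \<inter> (A (fst p) (snd p) \<inter> A (fst q) (snd q)))"
    using finite_V by (simp add: Int_def)
  also have "V \<inter> (A (fst p) (snd p) \<inter> A (fst q) (snd q)) = A (fst p) (snd p) \<inter> A (fst q) (snd q)"
    using sub by blast
  finally show ?thesis .
qed

lemma meet_self: "p \<in> cells \<Longrightarrow> meet p p = k"
  by (auto simp: meet_eq_card card_cell)

lemma inc_sum_treatments: "p \<in> cells \<Longrightarrow> (\<Sum>x\<in>V. inc p x) = k"
  using meet_self[of p] by (simp only: meet_def inc_idem)

text \<open>Two distinct cells in one row or one column are disjoint, since a treatment occurs only
  once in each line.\<close>

lemma meet_line:
  assumes "p \<in> cells" "q \<in> cells" "q \<notin> insert p (opp p)"
  shows "meet p q = 0"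
  unfolding meet_def
proof (intro sum.neutral ballI)
  fix x assume x: "x \<in> V"
  obtain i j i' j' where pq: "p = (i, j)" "q = (i', j')" by (cases p, cases q)
  have lt: "i < n" "j < n" "i' < n" "j' < n" using assms(1,2) by (auto simp: pq)
  have ex1: "\<exists>!j. j < n \<and> x \<in> A i j" "\<exists>!i. i < n \<and> x \<in> A i j"
    using x lt sls by (simp_all add: semi_latin_square_def)
  have "i = i' \<and> j \<noteq> j' \<or> i \<noteq> i' \<and> j = j'" using assms by (auto simp: pq opp_def)
  hence "\<not> (x \<in> A i j \<and> x \<in> A i' j')" using ex1 lt by blast
  thus "inc p x * inc q x = 0" by (auto simp: pq inc_def)
qed

text \<open>Cells sharing a line with \<open>p\<close> contribute \<open>g 0 = 0\<close> and
  \<open>p\<close> itself contributes \<open>g k\<close>. The cases needed are the identity and the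
  square.\<close>

lemma sum_meet_cells:
  assumes p: "p \<in> cells" and "g 0 = 0"
  shows "(\<Sum>q\<in>cells. g (meet p q)) = g k + (\<Sum>q\<in>opp p. g (meet p q))"
proof -
  have "(\<Sum>q\<in>cells. g (meet p q)) = (\<Sum>q\<in>insert p (opp p). g (meet p q))"
    by (rule sum.mono_neutral_right) (use assms meet_line[OF p] in \<open>auto simp: opp_def\<close>)
  also have "\<dots> = g k + (\<Sum>q\<in>opp p. g (meet p q))"
    using p by (subst sum.insert) (auto simp: opp_def meet_self)
  finally show ?thesis .
qed

lemma card_opp: "p \<in> cells \<Longrightarrow> card (opp p) = (n - 1)\<^sup>2"
  by (auto simp: opp_def card_cartesian_product power2_eq_square)

text \<open>Double counting: each of the \<open>k\<close> treatments in the block at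
  \<open>p\<close> lies in \<open>n\<close> cells, one of which is \<open>p\<close> while the others
  lie in \<open>opp p\<close>.\<close>

lemma sum_meet_opp:
  assumes p: "p \<in> cells"
  shows "(\<Sum>q\<in>opp p. meet p q) = k * (real n - 1)"
proof -
  have "k + (\<Sum>q\<in>opp p. meet p q) = (\<Sum>q\<in>cells. meet p q)"
    using sum_meet_cells[OF p, of "\<lambda>x. x"] by simp
  also have "\<dots> = (\<Sum>x\<in>V. inc p x * (\<Sum>q\<in>cells. inc q x))"
    unfolding meet_def sum_distrib_left by (rule sum.swap)
  also have "\<dots> = (\<Sum>x\<in>V. inc p x) * n"
    by (simp add: inc_sum_cells sum_distrib_right)
  also have "\<dots> = k * n" using p by (simp add: inc_sum_treatments)
  finally show ?thesis by (simp add: algebra_simps)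
qed

text \<open>Expanding about the mean \<open>m\<close>, the cross term is
  \<open>- 2 * k\<^sup>2\<close> and the constant term \<open>k\<^sup>2\<close>, so the squares over
  \<open>opp p\<close> exceed the squared deviations by \<open>k\<^sup>2\<close>. The cell
  \<open>p\<close> itself supplies the second \<open>k\<^sup>2\<close>.\<close>

lemma sum_meet_sq:
  assumes p: "p \<in> cells"
  shows "(\<Sum>q\<in>cells. (meet p q)\<^sup>2) = 2 * (real k)\<^sup>2 + (\<Sum>q\<in>opp p. (meet p q - k / (real n - 1))\<^sup>2)"
proof -
  define m where "m = k / (real n - 1)"
  have m: "m * (real n - 1) = k" using n_gt_2 by (simp add: m_def)
  have "(\<Sum>q\<in>opp p. (meet p q - m)\<^sup>2) = (\<Sum>q\<in>opp p. (meet p q)\<^sup>2 - 2 * m * meet p q + m\<^sup>2)"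
    by (intro sum.cong refl) (simp add: power2_eq_square algebra_simps)
  also have "\<dots> = (\<Sum>q\<in>opp p. (meet p q)\<^sup>2) - 2 * m * (k * (real n - 1)) + (m * (real n - 1))\<^sup>2"
    using n_gt_2 by (simp add: sum.distrib sum_subtractf sum_distrib_left[symmetric]
        sum_meet_opp[OF p] card_opp[OF p] power_mult_distrib of_nat_diff)
  also have "\<dots> = (\<Sum>q\<in>opp p. (meet p q)\<^sup>2) - 2 * k * (m * (real n - 1)) + (m * (real n - 1))\<^sup>2"
    by (simp add: mult_ac)
  also have "\<dots> = (\<Sum>q\<in>opp p. (meet p q)\<^sup>2) - (real k)\<^sup>2"
    unfolding m by (simp add: power2_eq_square)
  finally show ?thesis using sum_meet_cells[OF p, of power2] by (simp add: m_def)
qed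

lemma conc_sym: "conc x y = conc y x"
  by (simp add: conc_def mult.commute)

lemma conc_diag: "x \<in> V \<Longrightarrow> conc x x = n"
  using inc_sum_cells[of x] by (simp only: conc_def inc_idem)

lemma conc_row_sum:
  assumes "x \<in> V"
  shows "(\<Sum>y\<in>V. conc x y) = n * k"
proof -
  have "(\<Sum>y\<in>V. conc x y) = (\<Sum>p\<in>cells. inc p x * (\<Sum>y\<in>V. inc p y))"
    unfolding conc_def sum_distrib_left by (rule sum.swap)
  also have "\<dots> = (\<Sum>p\<in>cells. inc p x) * k"
    by (simp add: inc_sum_treatments sum_distrib_right)
  finally show ?thesis using assms by (simp add: inc_sum_cells)
qed

text \<open>The two Gram matrices of \<open>inc\<close> have the same sum of squared entries: both
  sums are the same fourfold sum over two treatments and two cells. This transfers concurrences to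
  block intersections, where \<open>sum_meet_sq\<close> applies.\<close>

lemma sum_conc_sq: "(\<Sum>x\<in>V. \<Sum>y\<in>V. (conc x y)\<^sup>2) = 2 * (real n * real k)\<^sup>2 + deviation"
proof -
  have "(\<Sum>x\<in>V. \<Sum>y\<in>V. (conc x y)\<^sup>2) =
      (\<Sum>x\<in>V. \<Sum>y\<in>V. \<Sum>p\<in>cells. \<Sum>q\<in>cells. (inc p x * inc q x) * (inc p y * inc q y))"
    unfolding conc_def power2_eq_square sum_product by (simp add: mult_ac)
  also have "\<dots> = (\<Sum>x\<in>V. \<Sum>p\<in>cells. \<Sum>q\<in>cells. \<Sum>y\<in>V. (inc p x * inc q x) * (inc p y * inc q y))"
    by (subst sum.swap, subst (2) sum.swap) (rule refl)
  also have "\<dots> = (\<Sum>x\<in>V. \<Sum>p\<in>cells. \<Sum>q\<in>cells. (inc p x * inc q x) * meet p q)"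
    by (simp add: meet_def sum_distrib_left)
  also have "\<dots> = (\<Sum>p\<in>cells. \<Sum>q\<in>cells. \<Sum>x\<in>V. (inc p x * inc q x) * meet p q)"
    by (subst sum.swap, subst (2) sum.swap) (rule refl)
  also have "\<dots> = (\<Sum>p\<in>cells. \<Sum>q\<in>cells. (meet p q)\<^sup>2)"
    by (simp add: meet_def sum_distrib_right[symmetric] power2_eq_square)
  also have "\<dots> = (\<Sum>p\<in>cells. 2 * (real k)\<^sup>2) + deviation"
    unfolding deviation_def sum.distrib[symmetric] by (intro sum.cong refl sum_meet_sq)
  also have "(\<Sum>p\<in>cells. 2 * (real k)\<^sup>2) = 2 * (real n * real k)\<^sup>2"
    by (simp add: power2_eq_square)
  finally show ?thesis .
qed

lemma uniform_iff_meet: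
  "uniform_semi_latin_square n k V A \<longleftrightarrow>
     (\<exists>\<mu>::nat. \<mu> > 0 \<and> (\<forall>p\<in>cells. \<forall>q\<in>opp p. meet p q = \<mu>))"
proof -
  have "(\<forall>i<n. \<forall>j<n. \<forall>i'<n. \<forall>j'<n. i \<noteq> i' \<and> j \<noteq> j' \<longrightarrow> card (A i j \<inter> A i' j') = \<mu>)
      \<longleftrightarrow> (\<forall>p\<in>cells. \<forall>q\<in>opp p. meet p q = \<mu>)" for \<mu> :: nat
    by (fastforce simp: opp_def meet_eq_card)
  thus ?thesis using sls by (simp add: uniform_semi_latin_square_def)
qed

lemma uniform_meet:
  assumes "p \<in> cells" "\<forall>q\<in>opp p. meet p q = \<mu>"
  shows "\<mu> * (real n - 1) = k"
proof -
  have "(real n - 1) * (\<mu> * (real n - 1)) = (\<Sum>q\<in>opp p. meet p q)"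
    using assms(2) card_opp[OF assms(1)] n_gt_2
    by (simp add: power2_eq_square of_nat_diff mult_ac)
  also have "\<dots> = (real n - 1) * k" using sum_meet_opp[OF assms(1)] by simp
  finally show ?thesis using n_gt_2 by simp
qed

lemma uniform_iff_deviation_0: "uniform_semi_latin_square n k V A \<longleftrightarrow> deviation = 0"
proof
  assume "uniform_semi_latin_square n k V A"
  then obtain \<mu> :: nat where \<mu>: "\<forall>p\<in>cells. \<forall>q\<in>opp p. meet p q = \<mu>"
    by (auto simp: uniform_iff_meet)
  have "\<mu> = k / (real n - 1)"
    using uniform_meet[of "(0, 0)" \<mu>] \<mu> n_gt_2 by (simp add: field_simps)
  hence "meet p q = k / (real n - 1)" if "p \<in> cells" "q \<in> opp p" for p q
    using \<mu> that by metis
  thus "deviation = 0" unfolding deviation_def by (intro sum.neutral ballI) simp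
next
  assume "deviation = 0"
  hence "(\<Sum>q\<in>opp p. (meet p q - k / (real n - 1))\<^sup>2) = 0" if "p \<in> cells" for p
    using that unfolding deviation_def
    by (subst (asm) sum_nonneg_eq_0_iff, simp, simp add: sum_nonneg, blast)
  moreover have "finite (opp p)" for p by (simp add: opp_def)
  ultimately have *: "meet p q = k / (real n - 1)" if "p \<in> cells" "q \<in> opp p" for p q
    using that by (simp add: sum_nonneg_eq_0_iff)
  \<comment> \<open>Uniformity asks for a natural number, so the common value
    \<open>k / (real n - 1)\<close> is identified with one particular intersection size; it is
    positive because \<open>k\<close> is.\<close>
  define \<mu> where "\<mu> = card (A 0 0 \<inter> A 1 1)"
  have 0: "(0, 0) \<in> cells" "(1, 1) \<in> opp (0, 0)" using n_gt_2 by (auto simp: opp_def)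
  have "\<mu> = k / (real n - 1)" using *[OF 0] 0(1) by (simp add: meet_eq_card \<mu>_def)
  moreover from this have "\<mu> > 0" using n_gt_2 k_pos by (cases "\<mu> = 0") (auto simp: field_simps)
  ultimately show "uniform_semi_latin_square n k V A"
    unfolding uniform_iff_meet using * by (intro exI[of _ \<mu>]) auto
qed

text \<open>From \<mu> * (n - 1) = k with \<mu> at least 1. This bound keeps the natural subtraction
  \<open>n * k - 1 - (n - 1)\<^sup>2\<close> from truncating.\<close>

lemma uniform_imp_k_ge:
  assumes "uniform_semi_latin_square n k V A"
  shows "n - 1 \<le> k"
proof -
  obtain \<mu> :: nat where \<mu>: "\<mu> > 0" "\<forall>p\<in>cells. \<forall>q\<in>opp p. meet p q = \<mu>"
    using assms by (auto simp: uniform_iff_meet)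
  have "real (\<mu> * (n - 1)) = real k"
    using uniform_meet[of "(0, 0)" \<mu>] \<mu> n_gt_2 by (simp add: of_nat_diff)
  hence "\<mu> * (n - 1) = k" by (simp only: of_nat_eq_iff)
  thus ?thesis using \<mu>(1) by auto
qed

text \<open>
  The row and column sums of the incidence vectors of the cells are the all-one vector. Hence all
  of them are combinations of the all-one vector (index \<open>(n - 1, n - 1)\<close> below) and of the
  cells outside the last row and the last column.
\<close>

lemma conc_rank_factorization:
  defines "m \<equiv> n - 1"
  defines "I \<equiv> insert (m, m) ({..<m} \<times> {..<m})"
  obtains g h where "\<And>x y. x \<in> V \<Longrightarrow> y \<in> V \<Longrightarrow> conc x y = (\<Sum>s\<in>I. g s x * h s y)"
proof -
  define g where "g s x = (if s = (m, m) then 1 else inc s x)" for s x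
  \<comment> \<open>\<open>h s y\<close> collects everything that multiplies \<open>g s x\<close>
    once the values of \<open>inc\<close> at \<open>x\<close> in the last row and column have been
    eliminated; values at \<open>y\<close> stay as they are.\<close>
  define h where "h s y = (if s = (m, m)
      then (\<Sum>i<m. inc (i, m) y) + (\<Sum>j<m. inc (m, j) y) + (1 - real m) * inc (m, m) y
      else inc s y - inc (fst s, m) y - inc (m, snd s) y + inc (m, m) y)" for s y
  have n: "n = Suc m" using n_gt_2 by (simp add: m_def)
  have "conc x y = (\<Sum>s\<in>I. g s x * h s y)" if xy: "x \<in> V" "y \<in> V" for x y
  proof -
    have row: "inc (i, m) x = 1 - (\<Sum>j<m. inc (i, j) x)" if "i < n" for i
      using inc_sum_row[OF xy(1) that] by (simp add: n)
    have col: "inc (m, j) x = 1 - (\<Sum>i<m. inc (i, j) x)" if "j < n" for j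
      using inc_sum_col[OF xy(1) that] by (simp add: n)
    \<comment> \<open>The corner is eliminated in two stages, by the last column and then by each
      row, which leaves the constant \<open>1 - real m\<close>.\<close>
    have "inc (m, m) x = 1 - (\<Sum>i<m. inc (i, m) x)" by (rule col) (simp add: n)
    also have "\<dots> = 1 - real m + (\<Sum>i<m. \<Sum>j<m. inc (i, j) x)"
      by (simp add: row n sum_subtractf)
    finally have corner: "inc (m, m) x = 1 - real m + (\<Sum>i<m. \<Sum>j<m. inc (i, j) x)" .
    let ?S = "\<lambda>f. \<Sum>i<m. \<Sum>j<m. inc (i, j) x * f i j"
    have "conc x y = (\<Sum>i<n. \<Sum>j<n. inc (i, j) x * inc (i, j) y)"
      by (simp add: conc_def sum.cartesian_product')
    also have "\<dots> = ?S (\<lambda>i j. inc (i, j) y) + (\<Sum>i<m. inc (i, m) x * inc (i, m) y)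
        + (\<Sum>j<m. inc (m, j) x * inc (m, j) y) + inc (m, m) x * inc (m, m) y"
      by (simp add: n sum.distrib)
    also have "(\<Sum>i<m. inc (i, m) x * inc (i, m) y) = (\<Sum>i<m. inc (i, m) y) - ?S (\<lambda>i j. inc (i, m) y)"
      by (simp add: row n sum_subtractf left_diff_distrib sum_distrib_right)
    also have "(\<Sum>j<m. inc (m, j) x * inc (m, j) y) = (\<Sum>j<m. inc (m, j) y) - (\<Sum>j<m. \<Sum>i<m. inc (i, j) x * inc (m, j) y)"
      by (simp add: col n sum_subtractf left_diff_distrib sum_distrib_right)
    also have "(\<Sum>j<m. \<Sum>i<m. inc (i, j) x * inc (m, j) y) = ?S (\<lambda>i j. inc (m, j) y)"
      by (rule sum.swap)
    also have "inc (m, m) x * inc (m, m) y = (1 - real m) * inc (m, m) y + ?S (\<lambda>i j. inc (m, m) y)"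
      by (simp add: corner distrib_right sum_distrib_right)
    finally have "conc x y = h (m, m) y +
        ?S (\<lambda>i j. inc (i, j) y - inc (i, m) y - inc (m, j) y + inc (m, m) y)"
      by (simp add: h_def distrib_left right_diff_distrib sum.distrib sum_subtractf)
    also have "?S (\<lambda>i j. inc (i, j) y - inc (i, m) y - inc (m, j) y + inc (m, m) y) =
        (\<Sum>s\<in>{..<m} \<times> {..<m}. g s x * h s y)"
      unfolding sum.cartesian_product' by (intro sum.cong refl) (auto simp: g_def h_def)
    finally show ?thesis by (simp add: I_def g_def)
  qed
  thus thesis by (rule that)
qed

section \<open>The information matrix and its spectrum\<close>

abbreviation "D \<equiv> underlying_design n V A"

lemma concurrence_eq_conc: "real (concurrence D x y) = conc x y"
proof -
  have "real (concurrence D x y) = (\<Sum>(i, j)\<in>cells. of_bool (x \<in> A i j \<and> y \<in> A i j))"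
    unfolding concurrence_def underlying_design_def snd_conv
    by (rule filter_map_product_length)
  also have "\<dots> = conc x y"
    unfolding conc_def inc_def by (intro sum.cong) auto
  finally show ?thesis .
qed

lemma is_design_underlying: "is_design (n * k) (n\<^sup>2) n k D"
proof -
  have "length (filter (\<lambda>B. x \<in> B) (snd D)) = n" if "x \<in> V" for x
  proof -
    have "length (filter (\<lambda>B. x \<in> B) (snd D)) = concurrence D x x"
      by (simp add: concurrence_def)
    moreover have "real (concurrence D x x) = real n"
      using that by (simp add: concurrence_eq_conc conc_diag)
    ultimately show ?thesis by simp
  qed
  moreover have "B \<subseteq> V \<and> card B = k" if B: "B \<in> set (snd D)" for B
  proof -
    obtain i j where "i < n" "j < n" "B = A i j"
      using B by (auto simp: underlying_design_def)
    thus ?thesis using cell_subset card_cell by simp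
  qed
  ultimately show ?thesis
    using finite_V card_V
    by (simp add: is_design_def underlying_design_def power2_eq_square length_product)
qed

abbreviation "info \<equiv> info_entry n k D"

lemma info_eq: "info x y = of_bool (x = y) - conc x y / (real n * real k)"
  by (simp add: info_entry_def concurrence_eq_conc)

lemma info_row_sum: "x \<in> V \<Longrightarrow> (\<Sum>y\<in>V. info x y) = 0"
  using n_gt_2 k_pos finite_V
  by (simp add: info_eq sum_subtractf conc_row_sum flip: sum_divide_distrib)

lemma info_trace: "(\<Sum>x\<in>V. info x x) = real n * real k - real n"
  using n_gt_2 k_pos card_V by (simp add: info_eq conc_diag field_simps)

text \<open>Expanding the square, the mixed term lives on the diagonal, where
  \<open>conc x x = n\<close>, and yields \<open>- 2 * n\<close>; the squared concurrences yield the
  2 and the deviation through \<open>sum_conc_sq\<close>.\<close>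

lemma info_trace_sq:
  "(\<Sum>x\<in>V. \<Sum>y\<in>V. info x y * info y x) =
     real n * real k - 2 * real n + 2 + deviation / (real n * real k)\<^sup>2"
proof -
  define N where "N = real n * real k"
  have N: "N > 0" using n_gt_2 k_pos by (simp add: N_def)
  have info_N: "info x y = of_bool (x = y) - conc x y / N" for x y
    by (simp add: info_eq N_def)
  have "info x y * info y x =
      of_bool (x = y) * (1 - 2 / N * conc x y) + (conc x y)\<^sup>2 / N\<^sup>2" for x y
    by (cases "x = y")
      (simp_all add: info_N conc_sym[of y x] power2_eq_square algebra_simps)
  hence "(\<Sum>x\<in>V. \<Sum>y\<in>V. info x y * info y x) =
      (\<Sum>x\<in>V. \<Sum>y\<in>V. of_bool (x = y) * (1 - 2 / N * conc x y) + (conc x y)\<^sup>2 / N\<^sup>2)"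
    by simp
  also have "\<dots> = (\<Sum>x\<in>V. 1 - 2 / N * n) + (2 * N\<^sup>2 + deviation) / N\<^sup>2"
    using finite_V
    by (simp add: sum.distrib sum_of_bool_mult_eq conc_diag sum_conc_sq N_def flip: sum_divide_distrib)
  also have "(\<Sum>x\<in>V. 1 - 2 / N * n) = N * (1 - 2 / N * n)"
    using card_V by (simp add: N_def)
  also have "\<dots> = N - 2 * n" using N by (simp add: field_simps)
  finally show ?thesis using N by (simp add: N_def[symmetric] add_divide_distrib)
qed

text \<open>The concurrence form is a sum of squares over the cells. Hence the information matrix is
  at most the identity, which bounds its eigenvalues by 1.\<close>

lemma info_quadratic_form:
  "(\<Sum>x\<in>V. \<Sum>y\<in>V. u x * info x y * u y) =
     (\<Sum>x\<in>V. (u x)\<^sup>2) - (\<Sum>p\<in>cells. (\<Sum>x\<in>V. inc p x * u x)\<^sup>2) / (real n * real k)"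
proof -
  have "(\<Sum>x\<in>V. \<Sum>y\<in>V. u x * info x y * u y) =
      (\<Sum>x\<in>V. \<Sum>y\<in>V. of_bool (x = y) * (u x * u y) - u x * conc x y * u y / (real n * real k))"
    by (simp add: info_eq algebra_simps)
  also have "\<dots> = (\<Sum>x\<in>V. (u x)\<^sup>2) - (\<Sum>x\<in>V. \<Sum>y\<in>V. u x * conc x y * u y) / (real n * real k)"
    using finite_V
    by (simp add: sum_subtractf sum_of_bool_mult_eq power2_eq_square flip: sum_divide_distrib)
  also have "(\<Sum>x\<in>V. \<Sum>y\<in>V. u x * conc x y * u y) =
      (\<Sum>x\<in>V. \<Sum>y\<in>V. \<Sum>p\<in>cells. (inc p x * u x) * (inc p y * u y))"
    by (simp add: conc_def sum_distrib_left sum_distrib_right mult_ac)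
  also have "\<dots> = (\<Sum>x\<in>V. \<Sum>p\<in>cells. \<Sum>y\<in>V. (inc p x * u x) * (inc p y * u y))"
    by (intro sum.cong refl sum.swap)
  also have "\<dots> = (\<Sum>p\<in>cells. \<Sum>x\<in>V. \<Sum>y\<in>V. (inc p x * u x) * (inc p y * u y))"
    by (rule sum.swap)
  also have "\<dots> = (\<Sum>p\<in>cells. (\<Sum>x\<in>V. inc p x * u x)\<^sup>2)"
    by (simp only: power2_eq_square sum_product)
  finally show ?thesis .
qed

text \<open>Gathers all spectral data used later: the eigenvalue 0 to be removed, the upper bound 1,
  the first two power sums, and the forced multiplicity of the eigenvalue 1.\<close>

lemma info_spectrum:
  obtains as where
    "proots (char_poly (info_matrix n k D)) = mset as" "length as = n * k"
    "0 \<in> set as" "\<And>a. a \<in> set as \<Longrightarrow> a \<le> 1"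
    "(\<Sum>a\<leftarrow>as. a) = real n * real k - real n"
    "(\<Sum>a\<leftarrow>as. a\<^sup>2) = real n * real k - 2 * real n + 2 + deviation / (real n * real k)\<^sup>2"
    "n * k - ((n - 1)\<^sup>2 + 1) \<le> count (mset as) 1"
proof -
  let ?N = "n * k"
  obtain e where "bij_betw e {0..<card V} V" using ex_bij_betw_nat_finite[OF finite_V] by blast
  hence e: "bij_betw e {..<?N} V" by (simp add: atLeast0LessThan card_V)
  have eV: "e i \<in> V" if "i < ?N" for i using e that by (auto simp: bij_betw_def)
  have e_eq: "e i = e j \<longleftrightarrow> i = j" if "i < ?N" "j < ?N" for i j
    using e that by (auto simp: bij_betw_def inj_on_def)
  have sum_e: "(\<Sum>i<?N. g (e i)) = (\<Sum>x\<in>V. g x)" for g :: "'a \<Rightarrow> real"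
    by (rule sum.reindex_bij_betw[OF e])
  define M where "M = matrix_along ?N e info"
  have M: "M \<in> carrier_mat ?N ?N" by (simp add: M_def matrix_along_def)
  have Me: "M $$ (i, j) = info (e i) (e j)" if "i < ?N" "j < ?N" for i j
    using that by (simp add: M_def matrix_along_def)
  have cp: "char_poly (info_matrix n k D) = char_poly M"
    unfolding info_matrix_def M_def using char_poly_enum_mat[of e V info] e card_V
    by (simp add: underlying_design_def)
  have M_sym: "M $$ (i, j) = M $$ (j, i)" if "i < ?N" "j < ?N" for i j
    using that by (simp add: Me info_eq conc_sym eq_commute)
  obtain as where as: "char_poly M = (\<Prod>a\<leftarrow>as. [:- a, 1:])" "length as = ?N"
    by (rule char_poly_symmetric_splits[OF M]) (use M_sym in blast)+
  have ev: "a \<in> set as \<longleftrightarrow> eigenvalue M a" for a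
    unfolding eigenvalue_root_char_poly[OF M] as(1)
    by (auto simp: poly_prod_list prod_list_zero_iff)
  have mult: "(M *\<^sub>v u) $ i = (\<Sum>j<?N. info (e i) (e j) * u $ j)"
    if "u \<in> carrier_vec ?N" "i < ?N" for u i
    using that M by (simp add: scalar_prod_def atLeast0LessThan Me)
  show ?thesis
  proof
    show roots: "proots (char_poly (info_matrix n k D)) = mset as"
      unfolding cp as(1) by (rule proots_prod_linear_factors)
    show "length as = ?N" by (rule as(2))
    \<comment> \<open>The all-one vector belongs to the eigenvalue 0 because the rows of the
      information matrix sum to 0.\<close>
    define u where "u = vec ?N (\<lambda>_. 1 :: real)"
    have "M *\<^sub>v u = 0 \<cdot>\<^sub>v u"
    proof (rule eq_vecI)
      fix i assume "i < dim_vec (0 \<cdot>\<^sub>v u)"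
      hence i: "i < ?N" by (simp add: u_def)
      have "(M *\<^sub>v u) $ i = (\<Sum>j<?N. info (e i) (e j))"
        using i by (subst mult) (auto simp: u_def)
      also have "\<dots> = 0" using info_row_sum[OF eV[OF i]] by (simp add: sum_e)
      finally show "(M *\<^sub>v u) $ i = (0 \<cdot>\<^sub>v u) $ i" using i by (simp add: u_def)
    qed (use M in \<open>simp add: u_def\<close>)
    moreover have "u \<noteq> 0\<^sub>v ?N"
    proof
      assume "u = 0\<^sub>v ?N"
      moreover have "0 < ?N" using n_gt_2 k_pos by simp
      ultimately have "u $ 0 = 0" by simp
      thus False using \<open>0 < ?N\<close> by (simp add: u_def)
    qed
    ultimately have "eigenvector M u 0" using M by (simp add: eigenvector_def u_def)
    thus "0 \<in> set as" unfolding ev eigenvalue_def by blast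
    show "a \<le> 1" if a: "a \<in> set as" for a
    proof -
      obtain w where w: "w \<in> carrier_vec ?N" "w \<noteq> 0\<^sub>v ?N" "M *\<^sub>v w = a \<cdot>\<^sub>v w"
        using a M unfolding ev eigenvalue_def eigenvector_def by auto
      \<comment> \<open>The eigenvector read as a function on treatments. Evaluating
        \<open>info_quadratic_form\<close> at \<open>f\<close> shows that \<open>1 - a\<close> times
        the squared norm of \<open>f\<close> is a nonnegative sum of squares.\<close>
      define f where "f x = w $ (inv_into {..<?N} e x)" for x
      have f: "f (e i) = w $ i" if "i < ?N" for i
        using that e by (simp add: f_def bij_betw_def)
      have row: "(\<Sum>j<?N. info (e i) (e j) * f (e j)) = a * f (e i)" if "i < ?N" for i
        using arg_cong[OF w(3), of "\<lambda>v. v $ i"] mult[OF w(1) that] that w(1) by (simp add: f)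
      have "(\<Sum>x\<in>V. \<Sum>y\<in>V. f x * info x y * f y) = (\<Sum>i<?N. \<Sum>j<?N. f (e i) * info (e i) (e j) * f (e j))"
        by (simp only: sum_e[of "\<lambda>y. f (e i) * info (e i) y * f y" for i]
            sum_e[of "\<lambda>x. \<Sum>y\<in>V. f x * info x y * f y"])
      also have "\<dots> = (\<Sum>i<?N. a * (f (e i))\<^sup>2)"
        by (intro sum.cong refl) (simp add: mult.assoc row power2_eq_square flip: sum_distrib_left)
      also have "\<dots> = a * (\<Sum>x\<in>V. (f x)\<^sup>2)"
        by (simp only: sum_distrib_left sum_e[of "\<lambda>x. a * (f x)\<^sup>2"])
      finally have "(1 - a) * (\<Sum>x\<in>V. (f x)\<^sup>2) =
          (\<Sum>p\<in>cells. (\<Sum>x\<in>V. inc p x * f x)\<^sup>2) / (real n * real k)"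
        unfolding info_quadratic_form by (simp add: left_diff_distrib)
      also have "\<dots> \<ge> 0" by (intro divide_nonneg_nonneg sum_nonneg) auto
      finally have nonneg: "0 \<le> (1 - a) * (\<Sum>x\<in>V. (f x)\<^sup>2)" .
      obtain i where i: "i < ?N" "w $ i \<noteq> 0"
        using w(1,2) by (metis carrier_vecD eq_vecI index_zero_vec)
      have "(\<Sum>x\<in>V. (f x)\<^sup>2) > 0"
        by (rule sum_pos2[OF finite_V eV[OF i(1)]]) (use i f in auto)
      with nonneg show ?thesis by (simp add: zero_le_mult_iff)
    qed
    show "(\<Sum>a\<leftarrow>as. a) = real n * real k - real n"
      using sum_diag_eq_sum_roots(1)[OF M as(1)] info_trace
      by (simp add: Me sum_e[of "\<lambda>x. info x x"])
    have "(\<Sum>a\<leftarrow>as. a\<^sup>2) = (\<Sum>i<?N. (M * M) $$ (i, i))"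
      using sum_diag_eq_sum_roots(2)[OF M as(1)] by simp
    also have "\<dots> = (\<Sum>i<?N. \<Sum>j<?N. info (e i) (e j) * info (e j) (e i))"
      using M by (intro sum.cong refl) (auto simp: scalar_prod_def atLeast0LessThan Me)
    also have "\<dots> = (\<Sum>x\<in>V. \<Sum>y\<in>V. info x y * info y x)"
      by (simp only: sum_e[of "\<lambda>y. info (e i) y * info y (e i)" for i]
          sum_e[of "\<lambda>x. \<Sum>y\<in>V. info x y * info y x"])
    finally show "(\<Sum>a\<leftarrow>as. a\<^sup>2) =
        real n * real k - 2 * real n + 2 + deviation / (real n * real k)\<^sup>2"
      by (simp add: info_trace_sq)
    define I where "I = insert (n - 1, n - 1) ({..<n - 1} \<times> {..<n - 1})"
    obtain g h where gh: "\<And>x y. x \<in> V \<Longrightarrow> y \<in> V \<Longrightarrow> conc x y = (\<Sum>s\<in>I. g s x * h s y)"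
      using conc_rank_factorization unfolding I_def by metis
    define r where "r = (n - 1)\<^sup>2 + 1"
    have "finite I" "card I = r" by (simp_all add: I_def r_def card_cartesian_product power2_eq_square)
    then obtain c where c: "bij_betw c {..<r} I"
      using ex_bij_betw_nat_finite[of I] by (auto simp: atLeast0LessThan)
    \<comment> \<open>The factorization of \<open>conc\<close> over the \<open>r\<close> indices in
      \<open>I\<close>, written as a matrix product with the scaling absorbed into \<open>X\<close>,
      exhibits \<open>M\<close> as the identity minus a product through dimension
      \<open>r\<close>.\<close>
    define X where "X = mat ?N r (\<lambda>(i, s). g (c s) (e i) / (real n * real k))"
    define Y where "Y = mat r ?N (\<lambda>(s, j). h (c s) (e j))"
    have XY: "X \<in> carrier_mat ?N r" "Y \<in> carrier_mat r ?N" by (simp_all add: X_def Y_def)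
    have "M = 1 \<cdot>\<^sub>m 1\<^sub>m ?N - X * Y"
    proof (rule eq_matI)
      fix i j assume "i < dim_row (1 \<cdot>\<^sub>m 1\<^sub>m ?N - X * Y)" "j < dim_col (1 \<cdot>\<^sub>m 1\<^sub>m ?N - X * Y)"
      hence ij: "i < ?N" "j < ?N" using XY by auto
      have "(X * Y) $$ (i, j) = (\<Sum>s<r. g (c s) (e i) / (real n * real k) * h (c s) (e j))"
        using ij XY by (simp add: scalar_prod_def atLeast0LessThan X_def Y_def)
      also have "\<dots> = (\<Sum>s\<in>I. g s (e i) / (real n * real k) * h s (e j))"
        by (rule sum.reindex_bij_betw[OF c])
      also have "\<dots> = conc (e i) (e j) / (real n * real k)"
        by (simp add: gh[OF eV[OF ij(1)] eV[OF ij(2)]] sum_divide_distrib)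
      finally show "M $$ (i, j) = (1 \<cdot>\<^sub>m 1\<^sub>m ?N - X * Y) $$ (i, j)"
        using ij XY by (simp add: Me info_eq e_eq)
    qed (use M XY in auto)
    from order_char_poly_low_rank_perturbation[OF XY this]
    have "?N - r \<le> Polynomial.order 1 (char_poly M)" .
    also have "\<dots> = count (mset as) 1"
      using roots degree_monic_char_poly[OF M] unfolding cp by (metis count_proots degree_0 coeff_0 zero_neq_one)
    finally show "?N - ((n - 1)\<^sup>2 + 1) \<le> count (mset as) 1" by (simp add: r_def)
  qed
qed

text \<open>\<open>R\<close> is what remains after one 0 and the forced ones are removed; it may
  itself contain further ones or zeros. Its first two power sums come from the traces.\<close>

lemma efficiency_factors_split:
  assumes "n - 1 \<le> k"
  defines "c \<equiv> 1 - 1 / (real n - 1)"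
  obtains R where
    "sls_efficiency_factors n k V A = R + replicate_mset (n * k - 1 - (n - 1)\<^sup>2) 1"
    "size R = (n - 1)\<^sup>2" "\<And>x. x \<in># R \<Longrightarrow> x \<le> 1"
    "(\<Sum>x\<in>#R. x) = real (size R) * c"
    "(\<Sum>x\<in>#R. (x - c)\<^sup>2) = deviation / (real n * real k)\<^sup>2"
proof -
  define m where "m = n - 1"
  have m: "n = Suc m" "m \<ge> 2" using n_gt_2 by (auto simp: m_def)
  have c: "real m * c = real m - 1" using m by (simp add: c_def field_simps)
  define q where "q = n * k - 1 - m\<^sup>2"
  \<comment> \<open>The bound on \<open>k\<close> ensures that \<open>q\<close> is a genuine
    difference, so the multiplicities add up to \<open>n * k\<close>.\<close>
  have "Suc m * m \<le> n * k" using assms(1) m by (intro mult_le_mono) auto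
  moreover have "m\<^sup>2 + 1 \<le> Suc m * m" using m by (simp add: power2_eq_square)
  ultimately have q: "n * k = q + m\<^sup>2 + 1" by (simp add: q_def)
  have qr: "real n * real k = real q + (real m)\<^sup>2 + 1"
    using arg_cong[OF q, of real] by simp
  obtain as where as: "proots (char_poly (info_matrix n k D)) = mset as" "length as = n * k"
    "0 \<in> set as" "\<And>a. a \<in> set as \<Longrightarrow> a \<le> 1"
    "(\<Sum>a\<leftarrow>as. a) = real n * real k - real n"
    "(\<Sum>a\<leftarrow>as. a\<^sup>2) = real n * real k - 2 * real n + 2 + deviation / (real n * real k)\<^sup>2"
    "n * k - ((n - 1)\<^sup>2 + 1) \<le> count (mset as) 1"
    using info_spectrum by blast
  define E where "E = mset as - {#0#}"
  have E: "mset as = add_mset 0 E" using as(3) by (simp add: E_def)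
  have "q \<le> count E 1" using as(7) E q by (simp add: m_def)
  hence "replicate_mset q 1 \<subseteq># E" by (simp add: count_le_replicate_mset_subset_eq)
  then obtain R where R: "E = R + replicate_mset q 1"
    by (metis subset_mset.diff_add)
  have asR: "mset as = add_mset 0 (R + replicate_mset q 1)" using E R by simp
  have sums: "(\<Sum>a\<leftarrow>as. g a) = g 0 + (\<Sum>x\<in>#R. g x) + q * g 1" for g :: "real \<Rightarrow> real"
  proof -
    have "(\<Sum>a\<leftarrow>as. g a) = sum_mset (image_mset g (mset as))"
      by (simp flip: sum_mset_sum_list)
    thus ?thesis by (simp add: asR)
  qed
  have size: "size R = m\<^sup>2" using arg_cong[OF asR, of size] as(2) q by simp
  show ?thesis
  proof
    show "sls_efficiency_factors n k V A = R + replicate_mset (n * k - 1 - (n - 1)\<^sup>2) 1"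
      by (simp add: sls_efficiency_factors_def canonical_efficiency_factors_def as(1)
          E_def[symmetric] R q_def m_def)
    show "size R = (n - 1)\<^sup>2" using size by (simp add: m_def)
    show "x \<le> 1" if "x \<in># R" for x
    proof -
      have "x \<in># mset as" using that by (simp add: asR)
      thus ?thesis using as(4) by simp
    qed
    have "(real m)\<^sup>2 * c = real m * (real m * c)" by (simp add: power2_eq_square)
    also have "\<dots> = real m * (real m - 1)" by (simp only: c)
    finally have mc: "(real m)\<^sup>2 * c = real m * (real m - 1)" .
    have "(real m)\<^sup>2 * c\<^sup>2 = (real m * c)\<^sup>2" by (simp add: power_mult_distrib)
    also have "\<dots> = (real m - 1)\<^sup>2" by (simp only: c)
    finally have mc2: "(real m)\<^sup>2 * c\<^sup>2 = (real m - 1)\<^sup>2" .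
    \<comment> \<open>Subtracting the \<open>q\<close> ones from the trace leaves
      \<open>m\<^sup>2 - m\<close>, which is \<open>m\<^sup>2\<close> times \<open>c\<close>. The
      second power sum likewise leaves \<open>(m - 1)\<^sup>2\<close>, which is
      \<open>m\<^sup>2 * c\<^sup>2\<close>, plus the deviation term.\<close>
    have s1: "(\<Sum>x\<in>#R. x) = real m * (real m - 1)"
      using sums[of "\<lambda>x. x"] as(5) unfolding qr by (simp add: m power2_eq_square algebra_simps)
    thus "(\<Sum>x\<in>#R. x) = real (size R) * c" by (simp add: size mc)
    have s2: "(\<Sum>x\<in>#R. x\<^sup>2) = (real m - 1)\<^sup>2 + deviation / (real n * real k)\<^sup>2"
      using sums[of "\<lambda>x. x\<^sup>2"] as(6) unfolding qr by (simp add: m power2_eq_square algebra_simps)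
    have "(\<Sum>x\<in>#R. (x - c)\<^sup>2) = (\<Sum>x\<in>#R. x\<^sup>2) - 2 * c * (\<Sum>x\<in>#R. x) + real (size R) * c\<^sup>2"
      by (induction R) (simp_all add: power2_eq_square algebra_simps)
    also have "2 * c * (\<Sum>x\<in>#R. x) = 2 * (real m - 1) * (real m * c)"
      unfolding s1 by simp
    finally show "(\<Sum>x\<in>#R. (x - c)\<^sup>2) = deviation / (real n * real k)\<^sup>2"
      unfolding c by (simp add: s2 size mc2) (simp add: power2_eq_square)
  qed
qed

text \<open>Uniformity is a vanishing deviation, hence a vanishing sum of squares over
  \<open>R\<close>, hence \<open>R\<close> constantly \<open>c\<close>; the forced ones cancel on
  both sides.\<close>

lemma uniform_iff_efficiency_factors:
  assumes "n - 1 \<le> k"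
  shows "uniform_semi_latin_square n k V A \<longleftrightarrow>
    sls_efficiency_factors n k V A = replicate_mset ((n - 1)\<^sup>2) (1 - 1 / (real n - 1)) +
      replicate_mset (n * k - 1 - (n - 1)\<^sup>2) 1"
proof -
  define c where "c = 1 - 1 / (real n - 1)"
  obtain R where R:
    "sls_efficiency_factors n k V A = R + replicate_mset (n * k - 1 - (n - 1)\<^sup>2) 1"
    "size R = (n - 1)\<^sup>2"
    "(\<Sum>x\<in>#R. (x - c)\<^sup>2) = deviation / (real n * real k)\<^sup>2"
    using efficiency_factors_split[OF assms] unfolding c_def by metis
  have nk: "real n * real k \<noteq> 0" using n_gt_2 k_pos by simp
  have "(\<Sum>x\<in>#R. (x - c)\<^sup>2) = 0 \<longleftrightarrow> (\<forall>x\<in>#R. x = c)"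
  proof (induction R)
    case (add x R)
    have "0 \<le> (\<Sum>x\<in>#R. (x - c)\<^sup>2)" by (induction R) auto
    with add show ?case by (simp add: add_nonneg_eq_0_iff)
  qed simp
  also have "(\<forall>x\<in>#R. x = c) \<longleftrightarrow> R = replicate_mset (size R) c"
  proof
    show "R = replicate_mset (size R) c" if "\<forall>x\<in>#R. x = c"
      using that by (induction R) auto
  qed (metis in_replicate_mset)
  finally have "deviation = 0 \<longleftrightarrow> R = replicate_mset ((n - 1)\<^sup>2) c"
    using R nk by simp
  thus ?thesis unfolding uniform_iff_deviation_0 R(1) c_def by simp
qed

end

section \<open>Prefix sums of sorted lists and averaging\<close>

lemma sum_list_le_length_mult:
  fixes xs :: "real list" and c :: real
  shows "(\<And>x. x \<in> set xs \<Longrightarrow> x \<le> c) \<Longrightarrow> sum_list xs \<le> length xs * c"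
    and "(\<And>x. x \<in> set xs \<Longrightarrow> c \<le> x) \<Longrightarrow> length xs * c \<le> sum_list xs"
  by (induction xs) (force simp: algebra_simps)+

text \<open>If the entry at position \<open>l\<close> exceeds the mean \<open>c\<close>, so does the
  whole tail, and the prefix must compensate. Otherwise every entry of the prefix is at most
  \<open>c\<close>.\<close>

lemma sum_list_take_sorted_le:
  fixes xs :: "real list" and c :: real
  assumes "sorted xs" "sum_list xs = length xs * c" "l \<le> length xs"
  shows "sum_list (take l xs) \<le> l * c"
proof (cases "l < length xs \<and> c < xs ! l")
  case True
  have "c \<le> x" if x: "x \<in> set (drop l xs)" for x
  proof -
    obtain i where "i < length xs - l" "x = xs ! (l + i)"
      using x by (auto simp: in_set_conv_nth)
    moreover from this have "xs ! l \<le> xs ! (l + i)"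
      using assms(1) by (intro sorted_nth_mono) auto
    ultimately show ?thesis using True by simp
  qed
  hence "real (length xs - l) * c \<le> sum_list (drop l xs)"
    using sum_list_le_length_mult(2)[of "drop l xs" c] by simp
  moreover have "sum_list (take l xs) + sum_list (drop l xs) = length xs * c"
    using assms(2) by (simp flip: sum_list_append)
  ultimately show ?thesis using assms(3) by (simp add: of_nat_diff algebra_simps)
next
  case False
  show ?thesis
  proof (cases "l = length xs")
    case True
    thus ?thesis using assms(2) by simp
  next
    case neq: False
    have "x \<le> c" if x: "x \<in> set (take l xs)" for x
    proof -
      obtain i where "i < l" "x = xs ! i"
        using x by (auto simp: in_set_conv_nth)
      with False neq assms(1,3) sorted_nth_mono[of xs i l] show ?thesis by simp
    qed
    thus ?thesis using sum_list_le_length_mult(1)[of "take l xs" c] assms(3) by simp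
  qed
qed

text \<open>Each entry is recovered by cancelling one prefix sum from the next.\<close>

lemma sum_list_take_eq_imp_eq:
  fixes xs ys :: "'a :: cancel_comm_monoid_add list"
  assumes "length xs = length ys"
    and "\<And>l. l \<le> length xs \<Longrightarrow> sum_list (take l xs) = sum_list (take l ys)"
  shows "xs = ys"
proof (rule nth_equalityI)
  fix i assume "i < length xs"
  thus "xs ! i = ys ! i"
    using assms(1) assms(2)[of i] assms(2)[of "Suc i"] by (simp add: take_Suc_conv_app_nth)
qed (rule assms(1))

lemma sorted_list_of_multiset_plus_max:
  assumes "\<And>x. x \<in># R \<Longrightarrow> x \<le> b"
  shows "sorted_list_of_multiset (R + replicate_mset q b) = sorted_list_of_multiset R @ replicate q b"
proof -
  have "sorted_list_of_multiset (R + replicate_mset q b) =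
      sorted_list_of_multiset (mset (sorted_list_of_multiset R @ replicate q b))" by simp
  also have "\<dots> = sort (sorted_list_of_multiset R @ replicate q b)"
    by (rule sorted_list_of_multiset_mset)
  also have "\<dots> = sorted_list_of_multiset R @ replicate q b"
    by (rule sorted_sort_id) (auto simp: sorted_append assms)
  finally show ?thesis .
qed

text \<open>Both sorted lists end in the same copies of \<open>b\<close>, where
  \<open>c \<le> b\<close> keeps the averaged list sorted. Within the first \<open>size R\<close>
  entries the previous averaging bound applies; beyond them the two sums agree.\<close>

lemma prefix_sums_le_averaged:
  fixes R :: "real multiset"
  assumes "\<And>x. x \<in># R \<Longrightarrow> x \<le> b" "(\<Sum>x\<in>#R. x) = real (size R) * c" "c \<le> b"
  shows "sum_list (take l (sorted_list_of_multiset (R + replicate_mset q b)))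
    \<le> sum_list (take l (sorted_list_of_multiset (replicate_mset (size R) c + replicate_mset q b)))"
proof -
  define xs where "xs = sorted_list_of_multiset R"
  have len: "length xs = size R" by (metis xs_def mset_sorted_list_of_multiset size_mset)
  have sum: "sum_list xs = length xs * c"
    unfolding len using assms(2) by (simp add: xs_def flip: sum_mset_sum_list)
  have "sorted_list_of_multiset (replicate_mset (size R) c) = replicate (size R) c"
    by (metis mset_replicate sorted_list_of_multiset_mset sorted_replicate sorted_sort_id)
  hence tgt: "sorted_list_of_multiset (replicate_mset (size R) c + replicate_mset q b) =
      replicate (length xs) c @ replicate q b"
    using assms(3) by (subst sorted_list_of_multiset_plus_max) (auto simp: len split: if_splits)
  have src: "sorted_list_of_multiset (R + replicate_mset q b) = xs @ replicate q b"
    unfolding xs_def by (rule sorted_list_of_multiset_plus_max[OF assms(1)])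
  show ?thesis
  proof (cases "l \<le> length xs")
    case True
    have "sorted xs" by (simp add: xs_def)
    from sum_list_take_sorted_le[OF this sum True] True show ?thesis
      by (simp add: src tgt sum_list_replicate min_def)
  next
    case False
    thus ?thesis by (simp add: src tgt sum_list_replicate sum)
  qed
qed

section \<open>Schur optimality\<close>

lemma (in semi_latin) size_efficiency_factors:
  assumes "n - 1 \<le> k"
  shows "size (sls_efficiency_factors n k V A) = (n - 1)\<^sup>2 + (n * k - 1 - (n - 1)\<^sup>2)"
  using efficiency_factors_split[OF assms] by (metis size_union size_replicate_mset)

lemma (in semi_latin) prefix_sums_efficiency_factors_le:
  assumes "n - 1 \<le> k"
  shows "sum_list (take l (sorted_list_of_multiset (sls_efficiency_factors n k V A)))
    \<le> sum_list (take l (sorted_list_of_multiset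
        (replicate_mset ((n - 1)\<^sup>2) (1 - 1 / (real n - 1)) +
         replicate_mset (n * k - 1 - (n - 1)\<^sup>2) 1)))"
proof -
  have "1 - 1 / (real n - 1) \<le> 1" using n_gt_2 by simp
  thus ?thesis
    using efficiency_factors_split[OF assms] prefix_sums_le_averaged by metis
qed

lemma semi_latin_if_uniform: "uniform_semi_latin_square n k V A \<Longrightarrow> semi_latin n k V A"
  by unfold_locales (simp add: uniform_semi_latin_square_def)

theorem theorem2:
  fixes n k :: nat and V :: "'a set" and S :: "nat \<Rightarrow> nat \<Rightarrow> 'a set"
  assumes "n > 2"
    and "uniform_semi_latin_square n k V S"
  shows "sls_efficiency_factors n k V S =
           replicate_mset ((n - 1)\<^sup>2) (1 - 1 / (real n - 1)) +
           replicate_mset (n * k - 1 - (n - 1)\<^sup>2) 1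
       \<and> (\<forall>(W :: 'a set) T. uniform_semi_latin_square n k W T \<longleftrightarrow> schur_optimal_sls n k W T)"
proof -
  interpret S: semi_latin n k V S by (rule semi_latin_if_uniform[OF assms(2)])
  \<comment> \<open>This constrains only \<open>n\<close> and \<open>k\<close>, so the existence of
    \<open>S\<close> makes the spectral results available for every square with these
    parameters.\<close>
  have k: "n - 1 \<le> k" by (rule S.uniform_imp_k_ge[OF assms(2)])
  define q where "q = n * k - 1 - (n - 1)\<^sup>2"
  define F where "F = replicate_mset ((n - 1)\<^sup>2) (1 - 1 / (real n - 1)) + replicate_mset q 1"
  have "(n - 1) * (n - 1) + 1 \<le> n * (n - 1)"
    using assms(1) by (cases n) auto
  also have "\<dots> \<le> n * k" using k by simp
  finally have q: "(n - 1)\<^sup>2 + q = n * k - 1" by (simp add: q_def power2_eq_square)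
  have effS: "sls_efficiency_factors n k V S = F"
    using S.uniform_iff_efficiency_factors[OF k] assms(2) unfolding F_def q_def by blast
  have "uniform_semi_latin_square n k W T \<longleftrightarrow> schur_optimal_sls n k W T" for W :: "'a set" and T
  proof
    assume T: "uniform_semi_latin_square n k W T"
    interpret T: semi_latin n k W T by (rule semi_latin_if_uniform[OF T])
    have effT: "sls_efficiency_factors n k W T = F"
      using T.uniform_iff_efficiency_factors[OF k] T unfolding F_def q_def by blast
    \<comment> \<open>\<open>F\<close> dominates the prefix sums of every square in the class, and
      \<open>T\<close> attains it.\<close>
    have "is_design (n * k) (n\<^sup>2) n k E \<and>
        sum_list (take l (sorted_list_of_multiset (canonical_efficiency_factors n k E)))
        \<le> sum_list (take l (sorted_list_of_multiset F))"
      if E: "E \<in> sls_designs n k" for E :: "'a design" and l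
    proof -
      obtain V' A' where E_eq: "E = underlying_design n V' A'" and sls: "semi_latin_square n k V' A'"
        using E by (auto simp: sls_designs_def)
      interpret E: semi_latin n k V' A' by unfold_locales (rule sls)
      show ?thesis
        using E.is_design_underlying E.prefix_sums_efficiency_factors_le[OF k, of l]
        unfolding E_eq sls_efficiency_factors_def F_def q_def by blast
    qed
    moreover have "underlying_design n W T \<in> sls_designs n k"
      using T.sls by (auto simp: sls_designs_def)
    ultimately show "schur_optimal_sls n k W T"
      using T.sls effT by (simp add: schur_optimal_sls_def schur_optimal_def sls_efficiency_factors_def)
  next
    assume opt: "schur_optimal_sls n k W T"
    interpret T: semi_latin n k W T
      by unfold_locales (use opt in \<open>simp add: schur_optimal_sls_def\<close>)
    let ?E = "sls_efficiency_factors n k W T"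
    \<comment> \<open>\<open>S\<close> serves as the competitor: optimality against it bounds the
      prefix sums below by those of \<open>F\<close>, averaging bounds them above, and equal prefix
      sums force equal factors.\<close>
    have inS: "underlying_design n V S \<in> sls_designs n k"
      using S.sls by (auto simp: sls_designs_def)
    have sizeE: "size ?E = n * k - 1"
      using T.size_efficiency_factors[OF k] q by (simp add: q_def)
    have lenE: "length (sorted_list_of_multiset ?E) = n * k - 1"
      by (metis mset_sorted_list_of_multiset size_mset sizeE)
    have sizeF: "size F = n * k - 1" using q by (simp add: F_def)
    have lenF: "length (sorted_list_of_multiset F) = n * k - 1"
      by (metis mset_sorted_list_of_multiset size_mset sizeF)
    have "sum_list (take l (sorted_list_of_multiset ?E)) = sum_list (take l (sorted_list_of_multiset F))"
      if l: "l \<le> n * k - 1" for l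
    \<comment> \<open>Optimality only speaks of positive \<open>l\<close>; the empty prefix is
      trivial.\<close>
    proof (cases "l = 0")
      case False
      with l have "l \<in> {1..n * k - 1}" by simp
      hence "sum_list (take l (sorted_list_of_multiset F))
          \<le> sum_list (take l (sorted_list_of_multiset ?E))"
        using opt inS unfolding schur_optimal_sls_def schur_optimal_def
          sls_efficiency_factors_def effS[unfolded sls_efficiency_factors_def, symmetric] by blast
      moreover have "sum_list (take l (sorted_list_of_multiset ?E))
          \<le> sum_list (take l (sorted_list_of_multiset F))"
        using T.prefix_sums_efficiency_factors_le[OF k] unfolding F_def q_def .
      ultimately show ?thesis by simp
    qed simp
    hence "sorted_list_of_multiset ?E = sorted_list_of_multiset F"
      by (intro sum_list_take_eq_imp_eq) (simp_all add: lenE lenF)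
    hence "?E = F" by (metis mset_sorted_list_of_multiset)
    thus "uniform_semi_latin_square n k W T"
      using T.uniform_iff_efficiency_factors[OF k] unfolding F_def q_def by blast
  qed
  with effS show ?thesis unfolding F_def q_def by blast
qed

end
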